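(* Let $k,n\geq1$, let $p_1,\dots,p_n:A^*\otimes(\mathbb N^k)^n\to\mathbb N^k$ and $u,v:A^*\otimes(\mathbb N^k)^n\to A^*$ be maps. A language $L\subseteq A^*$ satisfies $\mathcal E^{p_1,\dots,p_n}_{u=v}$ if and only if there exists a finite colouring $(Q_1,\dots,Q_\ell)$ of $\mathbb N^k$, for some $\ell\geq1$, such that $\bigcup_{i=1}^\ell\bigcap_{j=1}^n p_j^{-1}(Q_i)\subseteq E_{L,u,v}$.
   Context: $A$ is a finite alphabet; $A^*\otimes(\mathbb N^k)^n$ is the set of tuples $(w,\bar i_1,\dots,\bar i_n)$ with $w\in A^*$ and each $\bar i_j\in\mathbb N^k$ having coordinates $<|w|$. $\beta(S)$ is the set of ultrafilters on $S$; for $f:S\to T$, $\beta f(\nu):=\{P\subseteq T: f^{-1}(P)\in\nu\}$. $L$ satisfies an equation $\gamma_1\leftrightarrow\gamma_2$ ($\gamma_i\in\beta(A^* )$) if $L\in\gamma_1\iff L\in\gamma_2$. $\mathcal E^{p_1,\dots,p_n}_{u=v}$ is the family of equations $\beta u(\nu)\leftrightarrow\beta v(\nu)$ for all $\nu\in\beta(A^*\otimes(\mathbb N^k)^n)$ with $\beta p_1(\nu)=\dots=\beta p_n(\nu)$. $E_{L,u,v}:=\{x: u(x)\in L\iff v(x)\in L\}$. A finite colouring of $\mathbb N^k$ with $\ell$ colours is a family of $\ell$ pairwise disjoint subsets covering $\mathbb N^k$. *)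

theory Defs
  imports "HOL-Analysis.Finite_Cartesian_Product" "HOL-Library.Disjoint_Sets"
begin

text \<open>
  The space \<open>\<nat>\<^sup>k\<close> is \<open>nat ^ 'k\<close> and \<open>(\<nat>\<^sup>k)\<^sup>n\<close> is \<open>(nat ^ 'k) ^ 'n\<close>, with \<open>'k\<close> and \<open>'n\<close> finite
  index types; these are nonempty, so \<open>k, n \<ge> 1\<close>.  The words over an alphabet \<open>A\<close> are
  \<open>lists A\<close>.  Since \<open>A\<^sup>* \<otimes> (\<nat>\<^sup>k)\<^sup>n\<close> is a proper subset of its type, ultrafilters and preimages
  are relative to a carrier set.
\<close>

definition tensor :: "'a set \<Rightarrow> ('a list \<times> ((nat ^ 'k) ^ 'n)) set" where
  "tensor A = {(w, i). w \<in> lists A \<and> (\<forall>j m. i $ j $ m < length w)}"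

definition ultrafilter_on :: "'s set \<Rightarrow> 's set set \<Rightarrow> bool" where
  "ultrafilter_on S U \<longleftrightarrow>
     U \<subseteq> Pow S \<and> S \<in> U \<and> {} \<notin> U \<and>
     (\<forall>P \<in> U. \<forall>R \<in> U. P \<inter> R \<in> U) \<and>
     (\<forall>P R. P \<in> U \<longrightarrow> P \<subseteq> R \<longrightarrow> R \<subseteq> S \<longrightarrow> R \<in> U) \<and>
     (\<forall>P. P \<subseteq> S \<longrightarrow> P \<in> U \<or> S - P \<in> U)"

definition beta :: "'s set \<Rightarrow> 's set set set" where
  "beta S = {U. ultrafilter_on S U}"

definition beta_map :: "'s set \<Rightarrow> 't set \<Rightarrow> ('s \<Rightarrow> 't) \<Rightarrow> 's set set \<Rightarrow> 't set set" where
  "beta_map S T f \<nu> = {P. P \<subseteq> T \<and> f -` P \<inter> S \<in> \<nu>}"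

lemma beta_map_in_beta:
  assumes f: "f \<in> S \<rightarrow> T" and \<nu>: "\<nu> \<in> beta S"
  shows "beta_map S T f \<nu> \<in> beta T"
proof -
  have U: "ultrafilter_on S \<nu>"
    using \<nu> by (simp add: beta_def)
  have top: "f -` T \<inter> S = S"
    using f by auto
  have int: "f -` (P \<inter> R) \<inter> S = (f -` P \<inter> S) \<inter> (f -` R \<inter> S)" for P R
    by auto
  have compl: "f -` (T - P) \<inter> S = S - (f -` P \<inter> S)" for P
    using f by auto
  have up: "f -` R \<inter> S \<in> \<nu>" if "f -` P \<inter> S \<in> \<nu>" "P \<subseteq> R" for P R
  proof -
    have "f -` P \<inter> S \<subseteq> f -` R \<inter> S" "f -` R \<inter> S \<subseteq> S"
      using that by auto
    then show ?thesis
      using U that(1) unfolding ultrafilter_on_def by blast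
  qed
  have "P \<inter> R \<in> beta_map S T f \<nu>" if "P \<in> beta_map S T f \<nu>" "R \<in> beta_map S T f \<nu>" for P R
    using that U int[of P R] unfolding beta_map_def ultrafilter_on_def by auto
  moreover have "P \<in> beta_map S T f \<nu> \<or> T - P \<in> beta_map S T f \<nu>" if "P \<subseteq> T" for P
  proof -
    have "f -` P \<inter> S \<in> \<nu> \<or> S - (f -` P \<inter> S) \<in> \<nu>"
      using U unfolding ultrafilter_on_def by (meson inf_le2)
    then show ?thesis
      using that unfolding beta_map_def by (auto simp: compl)
  qed
  moreover have "T \<in> beta_map S T f \<nu>" "{} \<notin> beta_map S T f \<nu>" "beta_map S T f \<nu> \<subseteq> Pow T"
    using U unfolding beta_map_def ultrafilter_on_def by (auto simp: top)
  moreover have "R \<in> beta_map S T f \<nu>" if "P \<in> beta_map S T f \<nu>" "P \<subseteq> R" "R \<subseteq> T" for P R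
    using that up unfolding beta_map_def by auto
  ultimately show ?thesis
    unfolding beta_def ultrafilter_on_def by blast
qed

definition satisfies_equation :: "'s set \<Rightarrow> 's set set \<Rightarrow> 's set set \<Rightarrow> bool" where
  "satisfies_equation L \<gamma>\<^sub>1 \<gamma>\<^sub>2 \<longleftrightarrow> (L \<in> \<gamma>\<^sub>1 \<longleftrightarrow> L \<in> \<gamma>\<^sub>2)"

text \<open>The pair \<open>(\<gamma>\<^sub>1, \<gamma>\<^sub>2)\<close> stands for the equation \<open>\<gamma>\<^sub>1 \<leftrightarrow> \<gamma>\<^sub>2\<close>.\<close>

definition satisfies_equations :: "'s set \<Rightarrow> ('s set set \<times> 's set set) set \<Rightarrow> bool" where
  "satisfies_equations L E \<longleftrightarrow> (\<forall>(\<gamma>\<^sub>1, \<gamma>\<^sub>2) \<in> E. satisfies_equation L \<gamma>\<^sub>1 \<gamma>\<^sub>2)"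

definition equation_family ::
  "'a set \<Rightarrow> ('n \<Rightarrow> 'a list \<times> ((nat ^ 'k) ^ 'n) \<Rightarrow> nat ^ 'k) \<Rightarrow>
   ('a list \<times> ((nat ^ 'k) ^ 'n) \<Rightarrow> 'a list) \<Rightarrow> ('a list \<times> ((nat ^ 'k) ^ 'n) \<Rightarrow> 'a list) \<Rightarrow>
   ('a list set set \<times> 'a list set set) set" where
  "equation_family A p u v =
     {(beta_map (tensor A) (lists A) u \<nu>, beta_map (tensor A) (lists A) v \<nu>) | \<nu>.
        \<nu> \<in> beta (tensor A) \<and>
        (\<forall>i j. beta_map (tensor A) UNIV (p i) \<nu> = beta_map (tensor A) UNIV (p j) \<nu>)}"

definition equalizer_set ::
  "'a set \<Rightarrow> 'a list set \<Rightarrow> ('a list \<times> ((nat ^ 'k) ^ 'n) \<Rightarrow> 'a list) \<Rightarrow>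
   ('a list \<times> ((nat ^ 'k) ^ 'n) \<Rightarrow> 'a list) \<Rightarrow> ('a list \<times> ((nat ^ 'k) ^ 'n)) set" where
  "equalizer_set A L u v = {x \<in> tensor A. u x \<in> L \<longleftrightarrow> v x \<in> L}"

definition finite_colouring :: "nat \<Rightarrow> (nat \<Rightarrow> (nat ^ 'k) set) \<Rightarrow> bool" where
  "finite_colouring l Q \<longleftrightarrow> disjoint_family_on Q {1..l} \<and> (\<Union>i\<in>{1..l}. Q i) = UNIV"

end

theory Submission
  imports Defs
begin

text \<open>
  The equality of the images of \<open>\<nu>\<close> under the \<open>p\<^sub>j\<close> means that \<open>\<nu>\<close> contains, for every set \<open>P\<close>
  of points, the set of all \<open>x\<close> whose values \<open>p\<^sub>j x\<close> lie either all inside or all outside \<open>P\<close>.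
  If \<open>\<nu>\<close> is such an ultrafilter, then some colour \<open>Q\<^sub>i\<close> belongs to the common image of \<open>\<nu>\<close>, so the
  finite intersection of the \<open>p\<^sub>j\<^sup>-\<^sup>1(Q\<^sub>i)\<close> belongs to \<open>\<nu>\<close>.  Conversely, if no finite colouring works,
  then these sets together with the complement of \<open>E\<close> have the finite intersection property,
  because finitely many sets \<open>P\<close> induce the finite colouring by their atoms; an ultrafilter
  containing all of them violates an equation.
\<close>

text \<open>In HOL the empty family has intersection \<open>UNIV\<close>. Intersecting with
  \<open>S\<close> makes the case of empty \<open>F\<close> say that \<open>S\<close> is
  nonempty.\<close>

definition fip_on :: "'s set \<Rightarrow> 's set set \<Rightarrow> bool" where
  "fip_on S M \<longleftrightarrow> M \<subseteq> Pow S \<and> (\<forall>F. finite F \<longrightarrow> F \<subseteq> M \<longrightarrow> S \<inter> \<Inter>F \<noteq> {})"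

lemma ultrafilter_on_Int: "ultrafilter_on S U \<Longrightarrow> P \<in> U \<Longrightarrow> R \<in> U \<Longrightarrow> P \<inter> R \<in> U"
  by (simp add: ultrafilter_on_def)

lemma ultrafilter_on_superset:
  "ultrafilter_on S U \<Longrightarrow> P \<in> U \<Longrightarrow> P \<subseteq> R \<Longrightarrow> R \<subseteq> S \<Longrightarrow> R \<in> U"
  unfolding ultrafilter_on_def by blast

lemma ultrafilter_on_diff_iff:
  assumes "ultrafilter_on S U" "P \<subseteq> S"
  shows "S - P \<in> U \<longleftrightarrow> P \<notin> U"
proof -
  have "P \<inter> (S - P) = {}" by blast
  then show ?thesis
    using assms unfolding ultrafilter_on_def by metis
qed

lemma ultrafilter_on_Inter:
  assumes U: "ultrafilter_on S U" and "finite F" "F \<subseteq> U"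
  shows "S \<inter> \<Inter>F \<in> U"
  using assms(2,3)
proof (induction F rule: finite_induct)
  case empty
  then show ?case using U by (simp add: ultrafilter_on_def)
next
  case (insert P F)
  have "S \<inter> \<Inter>(insert P F) = P \<inter> (S \<inter> \<Inter>F)" by auto
  then show ?case
    using insert U unfolding ultrafilter_on_def by auto
qed

text \<open>If \<open>U\<close> omitted every \<open>P i\<close>, it would contain all the
  complements and hence their finite intersection, which is empty.\<close>

lemma ultrafilter_on_finite_UN:
  assumes U: "ultrafilter_on S U" and "finite I" "\<And>i. i \<in> I \<Longrightarrow> P i \<subseteq> S" "(\<Union>i\<in>I. P i) = S"
  obtains i where "i \<in> I" "P i \<in> U"
proof (rule ccontr)
  assume "\<not> thesis"
  then have "(\<lambda>i. S - P i) ` I \<subseteq> U"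
    using that ultrafilter_on_diff_iff[OF U] assms(3) by auto
  then have "S \<inter> \<Inter>((\<lambda>i. S - P i) ` I) \<in> U"
    using ultrafilter_on_Inter[OF U] assms(2) by blast
  moreover have "S \<inter> \<Inter>((\<lambda>i. S - P i) ` I) = {}"
    using assms(4) by auto
  ultimately show False
    using U by (simp add: ultrafilter_on_def)
qed

text \<open>A finite part of the enlarged family is, up to \<open>P\<close> itself, a finite part
  \<open>F - {P}\<close> of \<open>M\<close>, to which \<open>meet\<close> applies. This is the
  extension step for maximal families.\<close>

lemma fip_on_insert:
  assumes M: "fip_on S M" and "P \<subseteq> S"
    and meet: "\<And>F. finite F \<Longrightarrow> F \<subseteq> M \<Longrightarrow> P \<inter> \<Inter>F \<noteq> {}"
  shows "fip_on S (insert P M)"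
  unfolding fip_on_def
proof (intro conjI allI impI)
  show "insert P M \<subseteq> Pow S"
    using M \<open>P \<subseteq> S\<close> by (simp add: fip_on_def)
  fix F assume "finite F" "F \<subseteq> insert P M"
  then have "P \<inter> \<Inter>(F - {P}) \<noteq> {}"
    by (intro meet) auto
  then show "S \<inter> \<Inter>F \<noteq> {}"
    using \<open>P \<subseteq> S\<close> by auto
qed

text \<open>A finite subfamily of the union of a nonempty chain already lies in one member of the
  chain. This supplies the upper bounds for Zorn's lemma.\<close>

lemma fip_on_Union_chain:
  assumes "C \<noteq> {}" and "subset.chain {M. fip_on S M} C"
  shows "fip_on S (\<Union>C)"
  unfolding fip_on_def
proof (intro conjI allI impI)
  have fip: "fip_on S M" if "M \<in> C" for M
    using assms(2) that by (auto simp: subset.chain_def)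
  then show "\<Union>C \<subseteq> Pow S"
    by (auto simp: fip_on_def)
  fix F assume F: "finite F" "F \<subseteq> \<Union>C"
  then obtain M where "M \<in> C" "F \<subseteq> M"
    using finite_subset_Union_chain assms by metis
  then show "S \<inter> \<Inter>F \<noteq> {}"
    using fip F by (auto simp: fip_on_def)
qed

text \<open>Zorn's lemma gives a maximal family with the finite intersection property above
  \<open>G\<close>; maximality makes it an ultrafilter.\<close>

lemma ultrafilter_on_extends_fip:
  assumes "fip_on S G"
  obtains U where "ultrafilter_on S U" "G \<subseteq> U"
proof -
  let ?\<A> = "{M. fip_on S M \<and> G \<subseteq> M}"
  have "\<exists>U\<in>?\<A>. \<forall>M\<in>?\<A>. U \<subseteq> M \<longrightarrow> M = U"
  proof (rule subset_Zorn_nonempty)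
    show "?\<A> \<noteq> {}" using assms by auto
    fix C assume C: "C \<noteq> {}" "subset.chain ?\<A> C"
    then have "subset.chain {M. fip_on S M} C"
      by (auto simp: subset.chain_def)
    then have "fip_on S (\<Union>C)"
      using C(1) by (rule fip_on_Union_chain[rotated])
    moreover have "C \<subseteq> ?\<A>"
      using C(2) by (simp add: subset.chain_def)
    then have "G \<subseteq> \<Union>C"
      using C(1) by blast
    ultimately show "\<Union>C \<in> ?\<A>" by blast
  qed
  then obtain U where U: "fip_on S U" "G \<subseteq> U"
    and max: "\<And>M. fip_on S M \<Longrightarrow> U \<subseteq> M \<Longrightarrow> M = U"
    by (smt (verit) mem_Collect_eq subset_trans)
  \<comment> \<open>Such a \<open>P\<close> can be adjoined to \<open>U\<close> without losing the
    finite intersection property, so maximality puts it in \<open>U\<close> already.\<close>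
  have memI: "P \<in> U" if "P \<subseteq> S" "\<And>F. finite F \<Longrightarrow> F \<subseteq> U \<Longrightarrow> P \<inter> \<Inter>F \<noteq> {}" for P
    using max[OF fip_on_insert[OF U(1) that]] by blast
  have nonempty: "S \<inter> \<Inter>F \<noteq> {}" if "finite F" "F \<subseteq> U" for F
    using U(1) that by (simp add: fip_on_def)
  have sub: "P \<subseteq> S" if "P \<in> U" for P
    using U(1) that by (auto simp: fip_on_def)
  \<comment> \<open>All closure properties are instances: \<open>H\<close> empty gives
    \<open>S\<close>, \<open>{P, R}\<close> gives intersections, \<open>{P}\<close> gives
    supersets.\<close>
  have up: "R \<in> U" if "finite H" "H \<subseteq> U" "S \<inter> \<Inter>H \<subseteq> R" "R \<subseteq> S" for H R
  proof (rule memI)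
    fix F assume "finite F" "F \<subseteq> U"
    then have "S \<inter> \<Inter>(H \<union> F) \<noteq> {}"
      using that by (intro nonempty) auto
    then show "R \<inter> \<Inter>F \<noteq> {}" using that by blast
  qed fact
  have "ultrafilter_on S U"
    unfolding ultrafilter_on_def
  proof (intro conjI ballI allI impI)
    show "U \<subseteq> Pow S" using sub by blast
    show "S \<in> U" by (rule up[of "{}"]) auto
    show "{} \<notin> U" using nonempty[of "{{}}"] by auto
    show "P \<inter> R \<in> U" if "P \<in> U" "R \<in> U" for P R
      using that sub by (intro up[of "{P, R}"]) auto
    show "R \<in> U" if "P \<in> U" "P \<subseteq> R" "R \<subseteq> S" for P R
      using that by (intro up[of "{P}"]) auto
    show "P \<in> U \<or> S - P \<in> U" if "P \<subseteq> S" for P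
    proof (rule disjCI)
      assume "S - P \<notin> U"
      \<comment> \<open>By \<open>memI\<close>, a set outside \<open>U\<close> misses some finite
        intersection of members; within \<open>S\<close> that intersection then lies in
        \<open>P\<close>.\<close>
      then obtain F where F: "finite F" "F \<subseteq> U" "(S - P) \<inter> \<Inter>F = {}"
        using memI[of "S - P"] by blast
      then show "P \<in> U" using that by (intro up[of F]) auto
    qed
  qed
  then show thesis using U(2) that by blast
qed

text \<open>The values of \<open>c\<close> are numbered from 1 and the colours are its fibres. At
  least one colour occurs because the domain is nonempty.\<close>

lemma finite_colouring_of_map:
  fixes c :: "nat ^ 'k \<Rightarrow> 'c"
  assumes "finite (range c)"
  obtains l Q where "l \<ge> 1" "finite_colouring l Q"
    "\<And>i s t. i \<in> {1..l} \<Longrightarrow> s \<in> Q i \<Longrightarrow> t \<in> Q i \<Longrightarrow> c s = c t"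
proof -
  obtain h where h: "bij_betw h {1..card (range c)} (range c)"
    using ex_bij_betw_nat_finite_1[OF assms] by blast
  define Q where "Q i = {t. c t = h i}" for i
  have "t \<in> (\<Union>i\<in>{1..card (range c)}. Q i)" for t
  proof -
    have "c t \<in> h ` {1..card (range c)}"
      using bij_betw_imp_surj_on[OF h] by simp
    then obtain i where "i \<in> {1..card (range c)}" "c t = h i"
      by (elim imageE)
    then show ?thesis by (auto simp: Q_def)
  qed
  then have "(\<Union>i\<in>{1..card (range c)}. Q i) = UNIV" by blast
  moreover have "disjoint_family_on Q {1..card (range c)}"
    unfolding disjoint_family_on_def Q_def
    using inj_onD[OF bij_betw_imp_inj_on[OF h]] by fastforce
  moreover have "card (range c) \<ge> 1"
    using assms by (simp add: Suc_leI card_gt_0_iff)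
  ultimately show thesis
    by (intro that[of "card (range c)" Q]) (simp_all add: finite_colouring_def Q_def)
qed

text \<open>This is the compactness argument for an arbitrary carrier \<open>S\<close> and target
  \<open>E\<close>, free of words and languages.\<close>

lemma equal_images_imp_mem_iff_finite_colouring:
  fixes p :: "'n::finite \<Rightarrow> 's \<Rightarrow> nat ^ 'k"
  assumes "E \<subseteq> S"
  shows "(\<forall>\<nu>\<in>beta S. (\<forall>i j. beta_map S UNIV (p i) \<nu> = beta_map S UNIV (p j) \<nu>) \<longrightarrow> E \<in> \<nu>) \<longleftrightarrow>
    (\<exists>l\<ge>1. \<exists>Q. finite_colouring l Q \<and> (\<Union>i\<in>{1..l}. \<Inter>j. p j -` Q i \<inter> S) \<subseteq> E)"
    (is "?lhs \<longleftrightarrow> ?rhs")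
proof
  assume ?rhs
  then obtain l Q where Q: "finite_colouring l Q"
    and E: "(\<Union>i\<in>{1..l}. \<Inter>j. p j -` Q i \<inter> S) \<subseteq> E" by blast
  show ?lhs
  proof (intro ballI impI)
    fix \<nu> assume "\<nu> \<in> beta S"
      and eq: "\<forall>i j. beta_map S UNIV (p i) \<nu> = beta_map S UNIV (p j) \<nu>"
    then have \<nu>: "ultrafilter_on S \<nu>" by (simp add: beta_def)
    \<comment> \<open>The index type is nonempty, so some index is available to select the colour;
      equality of the images then carries that colour to every other index.\<close>
    fix j\<^sub>0 :: 'n
    have "(\<Union>i\<in>{1..l}. p j\<^sub>0 -` Q i \<inter> S) = S"
      using Q unfolding finite_colouring_def by blast
    then obtain i where i: "i \<in> {1..l}" "p j\<^sub>0 -` Q i \<inter> S \<in> \<nu>"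
      using ultrafilter_on_finite_UN[OF \<nu>, of "{1..l}" "\<lambda>i. p j\<^sub>0 -` Q i \<inter> S"] by blast
    have "p j -` Q i \<inter> S \<in> \<nu>" for j
    proof -
      have "Q i \<in> beta_map S UNIV (p j) \<nu>"
        using i(2) eq[rule_format, of j j\<^sub>0] by (simp add: beta_map_def)
      then show ?thesis by (simp add: beta_map_def)
    qed
    then have "S \<inter> (\<Inter>j. p j -` Q i \<inter> S) \<in> \<nu>"
      by (intro ultrafilter_on_Inter[OF \<nu>]) auto
    moreover have "S \<inter> (\<Inter>j. p j -` Q i \<inter> S) \<subseteq> E" using E i(1) by blast
    ultimately show "E \<in> \<nu>"
      using ultrafilter_on_superset[OF \<nu>] assms by blast
  qed
next
  assume lhs: ?lhs
  show ?rhs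
  proof (rule ccontr)
    assume no: "\<not> ?rhs"
    define D where "D P = {x \<in> S. \<forall>i j. p i x \<in> P \<longleftrightarrow> p j x \<in> P}" for P
    have meet: "(S - E) \<inter> \<Inter>F \<noteq> {}" if F: "finite F" "F \<subseteq> range D" for F
    proof
      assume empty: "(S - E) \<inter> \<Inter>F = {}"
      obtain H where H: "finite H" "F = D ` H"
        using F by (meson finite_subset_image)
      \<comment> \<open>The value \<open>c t\<close> records which sets of \<open>H\<close> contain
        \<open>t\<close>, so its fibres are the atoms generated by \<open>H\<close>. If all
        \<open>p j x\<close> share an atom, then \<open>x\<close> lies in \<open>D P\<close> for
        every \<open>P\<close> in \<open>H\<close>.\<close>
      define c where "c t = {P \<in> H. t \<in> P}" for t
      have "finite (range c)"
        by (rule finite_subset[of _ "Pow H"]) (auto simp: c_def H)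
      then obtain l Q where Q: "l \<ge> 1" "finite_colouring l Q"
        and mono: "\<And>i s t. i \<in> {1..l} \<Longrightarrow> s \<in> Q i \<Longrightarrow> t \<in> Q i \<Longrightarrow> c s = c t"
        using finite_colouring_of_map by metis
      have "x \<in> E" if "i \<in> {1..l}" "x \<in> (\<Inter>j. p j -` Q i \<inter> S)" for x i
      proof -
        have "x \<in> S" using that by auto
        have "c (p j x) = c (p j' x)" for j j'
          by (rule mono[OF that(1)]) (use that(2) in auto)
        then have "p j x \<in> P \<longleftrightarrow> p j' x \<in> P" if "P \<in> H" for P j j'
          using that by (auto simp: c_def set_eq_iff)
        then have "x \<in> \<Inter>F"
          using \<open>x \<in> S\<close> by (simp add: H(2) D_def)
        then show ?thesis using empty \<open>x \<in> S\<close> by blast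
      qed
      then show False using no Q by blast
    qed
    \<comment> \<open>Both premises come from \<open>meet\<close>: a finite intersection that meets
      \<open>S - E\<close> certainly meets \<open>S\<close>.\<close>
    have "fip_on S (insert (S - E) (range D))"
    proof (rule fip_on_insert)
      show "fip_on S (range D)"
        unfolding fip_on_def
      proof (intro conjI allI impI)
        show "range D \<subseteq> Pow S" by (auto simp: D_def)
        show "S \<inter> \<Inter>F \<noteq> {}" if "finite F" "F \<subseteq> range D" for F
          using meet[OF that] by blast
      qed
    qed (rule Diff_subset, rule meet)
    then obtain \<nu> where \<nu>: "ultrafilter_on S \<nu>" "insert (S - E) (range D) \<subseteq> \<nu>"
      by (rule ultrafilter_on_extends_fip)
    \<comment> \<open>On \<open>D P\<close> the preimages of \<open>P\<close> under
      \<open>p i\<close> and \<open>p j\<close> agree. One inclusion of images suffices, since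
      \<open>i\<close> and \<open>j\<close> are arbitrary.\<close>
    have "P \<in> beta_map S UNIV (p j) \<nu>" if "P \<in> beta_map S UNIV (p i) \<nu>" for P i j
    proof -
      have "D P \<inter> (p i -` P \<inter> S) \<in> \<nu>"
        by (rule ultrafilter_on_Int[OF \<nu>(1)]) (use that \<nu>(2) in \<open>auto simp: beta_map_def\<close>)
      moreover have "D P \<inter> (p i -` P \<inter> S) \<subseteq> p j -` P \<inter> S"
        by (auto simp: D_def)
      ultimately have "p j -` P \<inter> S \<in> \<nu>"
        using ultrafilter_on_superset[OF \<nu>(1)] by blast
      then show ?thesis by (simp add: beta_map_def)
    qed
    then have "beta_map S UNIV (p i) \<nu> = beta_map S UNIV (p j) \<nu>" for i j by blast
    then have "E \<in> \<nu>"
      using lhs \<nu>(1) by (simp add: beta_def)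
    then show False
      using ultrafilter_on_diff_iff[OF \<nu>(1) assms] \<nu>(2) by blast
  qed
qed

text \<open>Intersecting the agreement set with \<open>P\<close> lands in \<open>R\<close>, and vice
  versa. Conversely, the agreement set contains both \<open>P \<inter> R\<close> and the
  intersection of the two complements, one of which is in \<open>U\<close>.\<close>

lemma ultrafilter_on_mem_iff:
  assumes U: "ultrafilter_on S U" and "P \<subseteq> S" "R \<subseteq> S"
  shows "{x \<in> S. x \<in> P \<longleftrightarrow> x \<in> R} \<in> U \<longleftrightarrow> (P \<in> U \<longleftrightarrow> R \<in> U)"
proof -
  let ?E = "{x \<in> S. x \<in> P \<longleftrightarrow> x \<in> R}"
  note int = ultrafilter_on_Int[OF U] and up = ultrafilter_on_superset[OF U]
  note compl = ultrafilter_on_diff_iff[OF U]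
  show ?thesis
  proof
    assume E: "?E \<in> U"
    show "P \<in> U \<longleftrightarrow> R \<in> U"
      using int[OF E, of P] int[OF E, of R] up[of "?E \<inter> P" R] up[of "?E \<inter> R" P] assms
      by blast
  next
    assume iff: "P \<in> U \<longleftrightarrow> R \<in> U"
    show "?E \<in> U"
    proof (cases "P \<in> U")
      case True
      then show ?thesis using iff int up[of "P \<inter> R" ?E] assms by blast
    next
      case False
      then have "(S - P) \<inter> (S - R) \<in> U" using iff int compl assms by blast
      then show ?thesis by (rule up) auto
    qed
  qed
qed

theorem mainTheorem12:
  fixes A :: "'a set"
    and p :: "'n::finite \<Rightarrow> 'a list \<times> ((nat ^ 'k::finite) ^ 'n) \<Rightarrow> nat ^ 'k"
    and u v :: "'a list \<times> ((nat ^ 'k) ^ 'n) \<Rightarrow> 'a list"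
    and L :: "'a list set"
  assumes "finite A"
    and "u \<in> tensor A \<rightarrow> lists A"
    and "v \<in> tensor A \<rightarrow> lists A"
    and "L \<subseteq> lists A"
  shows "satisfies_equations L (equation_family A p u v) \<longleftrightarrow>
    (\<exists>l\<ge>1. \<exists>Q. finite_colouring l Q \<and>
      (\<Union>i\<in>{1..l}. \<Inter>j. p j -` Q i \<inter> tensor A) \<subseteq> equalizer_set A L u v)"
proof -
  let ?S = "tensor A :: ('a list \<times> ((nat ^ 'k) ^ 'n)) set"
  \<comment> \<open>For each \<open>\<nu>\<close> the equation becomes a single membership in
    \<open>\<nu>\<close>: the equalizer set is where the preimages of \<open>L\<close> under
    \<open>u\<close> and \<open>v\<close> agree.\<close>
  have "satisfies_equation L (beta_map ?S (lists A) u \<nu>) (beta_map ?S (lists A) v \<nu>) \<longleftrightarrow>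
      equalizer_set A L u v \<in> \<nu>" if "\<nu> \<in> beta ?S" for \<nu>
  proof -
    have "equalizer_set A L u v = {x \<in> ?S. x \<in> u -` L \<inter> ?S \<longleftrightarrow> x \<in> v -` L \<inter> ?S}"
      by (auto simp: equalizer_set_def)
    then show ?thesis
      using ultrafilter_on_mem_iff[of ?S \<nu> "u -` L \<inter> ?S" "v -` L \<inter> ?S"] that assms(4)
      by (simp add: satisfies_equation_def beta_map_def beta_def)
  qed
  then have "satisfies_equations L (equation_family A p u v) \<longleftrightarrow>
      (\<forall>\<nu>\<in>beta ?S. (\<forall>i j. beta_map ?S UNIV (p i) \<nu> = beta_map ?S UNIV (p j) \<nu>) \<longrightarrow>
        equalizer_set A L u v \<in> \<nu>)"
    by (auto simp: satisfies_equations_def equation_family_def)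
  also have "\<dots> \<longleftrightarrow> (\<exists>l\<ge>1. \<exists>Q. finite_colouring l Q \<and>
      (\<Union>i\<in>{1..l}. \<Inter>j. p j -` Q i \<inter> ?S) \<subseteq> equalizer_set A L u v)"
    by (rule equal_images_imp_mem_iff_finite_colouring) (auto simp: equalizer_set_def)
  finally show ?thesis .
qed

end
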